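(* Let $p\geq5$ be a prime and let $n\geq r\geq1$ be integers. Then the group \[ G:=\langle x,y,z\mid x^{p^n}=y^{p^n}=z^{p^r}=1,\ [x,y]=z,\ [x,z]=[y,z]=1\rangle \] is a purely strongly real Beauville group.
   Context: Conventions: $g^h=hgh^{-1}$ and $[g,h]=ghg^{-1}h^{-1}$. For a finite group $G$ with identity $e$ and $x,y\in G$, let \[ \Sigma(x,y):=\bigcup_{i=1}^{|G|}\bigcup_{g\in G}\{(x^i)^g,(y^i)^g,((xy)^i)^g\}. \] A Beauville structure for a finite group $G$ is a set of pairs $\{(x_1,y_1),(x_2,y_2)\}\subset G\times G$ such that $\langle x_1,y_1\rangle=\langle x_2,y_2\rangle=G$ and $\Sigma(x_1,y_1)\cap\Sigma(x_2,y_2)=\{e\}$. The group $G$ is a Beauville group if it has a Beauville structure. A Beauville structure $\{(x_1,y_1),(x_2,y_2)\}$ of $G$ is strongly real if there exist an automorphism $\phi\in\mathrm{Aut}(G)$ and elements $g_1,g_2\in G$ such that $g_i\phi(x_i)g_i^{-1}=x_i^{-1}$ and $g_i\phi(y_i)g_i^{-1}=y_i^{-1}$ for $i=1,2$. A finite group $G$ is a purely strongly real Beauville group if $G$ is a Beauville group and every Beauville structure of $G$ is strongly real. *)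

theory Defs
  imports
    "HOL-Algebra.Bij"
    "HOL-Algebra.Generated_Groups"
    "HOL-Computational_Algebra.Primes"
begin

section \<open>Groups given by generators and relations\<close>

text \<open>
  A word over the generators \<^typ>\<open>'g\<close> is a list of signed letters: \<open>(a, True)\<close> stands for the
  generator \<open>a\<close> and \<open>(a, False)\<close> for its formal inverse.  Every element of the type \<^typ>\<open>'g\<close> is
  a generator.  A relation \<open>u = v\<close> is a pair of words \<open>(u, v)\<close>.
\<close>

type_synonym 'g letters = "('g \<times> bool) list"

definition gen :: "'g \<Rightarrow> 'g letters" where
  "gen a = [(a, True)]"

definition winv :: "'g letters \<Rightarrow> 'g letters" where
  "winv w = rev (map (\<lambda>(a, s). (a, \<not> s)) w)"

definition wpow :: "'g letters \<Rightarrow> nat \<Rightarrow> 'g letters" where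
  "wpow w k = concat (replicate k w)"

definition wcomm :: "'g letters \<Rightarrow> 'g letters \<Rightarrow> 'g letters" where
  "wcomm u v = u @ v @ winv u @ winv v"

text \<open>
  The least congruence on words that contains the free cancellations and the relations in \<open>R\<close>;
  the presented group is the quotient of the monoid of words by it.
\<close>

inductive pres_eq :: "('g letters \<times> 'g letters) set \<Rightarrow> 'g letters \<Rightarrow> 'g letters \<Rightarrow> bool"
  for R where
  cancel: "pres_eq R [(a, s), (a, \<not> s)] []"
| rel: "(u, v) \<in> R \<Longrightarrow> pres_eq R u v"
| app: "pres_eq R u u' \<Longrightarrow> pres_eq R v v' \<Longrightarrow> pres_eq R (u @ v) (u' @ v')"
| refl: "pres_eq R u u"
| sym: "pres_eq R u v \<Longrightarrow> pres_eq R v u"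
| trans: "pres_eq R u v \<Longrightarrow> pres_eq R v w \<Longrightarrow> pres_eq R u w"

definition wclass :: "('g letters \<times> 'g letters) set \<Rightarrow> 'g letters \<Rightarrow> 'g letters set" where
  "wclass R u = {v. pres_eq R u v}"

definition presented_group :: "('g letters \<times> 'g letters) set \<Rightarrow> 'g letters set monoid" where
  "presented_group R =
     \<lparr>carrier = range (wclass R),
      monoid.mult = (\<lambda>A B. \<Union>u\<in>A. \<Union>v\<in>B. wclass R (u @ v)),
      monoid.one = wclass R []\<rparr>"

lemma wclass_eq_iff: "wclass R u = wclass R v \<longleftrightarrow> pres_eq R u v"
  unfolding wclass_def
  by (metis Collect_cong mem_Collect_eq pres_eq.refl pres_eq.sym pres_eq.trans)

lemma presented_group_mult:
  "wclass R u \<otimes>\<^bsub>presented_group R\<^esub> wclass R v = wclass R (u @ v)"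
proof -
  have "wclass R (u' @ v') = wclass R (u @ v)" if "u' \<in> wclass R u" "v' \<in> wclass R v" for u' v'
    using that by (simp add: wclass_eq_iff) (simp add: wclass_def pres_eq.sym pres_eq.app)
  moreover have "u \<in> wclass R u" "v \<in> wclass R v"
    by (auto simp: wclass_def intro: pres_eq.refl)
  ultimately have "(\<Union>u'\<in>wclass R u. \<Union>v'\<in>wclass R v. wclass R (u' @ v')) = wclass R (u @ v)"
    by blast
  then show ?thesis
    by (simp add: presented_group_def)
qed

lemma pres_eq_winv_left: "pres_eq R (winv u @ u) []"
proof (induction u)
  case Nil
  show ?case by (simp add: winv_def pres_eq.refl)
next
  case (Cons l u)
  obtain a s where l: "l = (a, s)" by (cases l)
  have "pres_eq R [(a, \<not> s), (a, s)] []"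
    using pres_eq.cancel[of R a "\<not> s"] by simp
  then have "pres_eq R (winv u @ ([(a, \<not> s), (a, s)] @ u)) (winv u @ ([] @ u))"
    by (intro pres_eq.app pres_eq.refl)
  then have "pres_eq R (winv u @ ([(a, \<not> s), (a, s)] @ u)) []"
    using Cons pres_eq.trans by fastforce
  then show ?case
    by (simp add: winv_def l)
qed

lemma group_presented_group: "group (presented_group R)"
proof (rule groupI)
  fix A assume "A \<in> carrier (presented_group R)"
  then obtain u where u: "A = wclass R u"
    by (auto simp: presented_group_def)
  have one: "\<one>\<^bsub>presented_group R\<^esub> = wclass R []"
    by (simp add: presented_group_def)
  show "\<one>\<^bsub>presented_group R\<^esub> \<otimes>\<^bsub>presented_group R\<^esub> A = A"
    by (simp add: u one presented_group_mult)
  have "wclass R (winv u) \<otimes>\<^bsub>presented_group R\<^esub> A = \<one>\<^bsub>presented_group R\<^esub>"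
    by (simp add: u one presented_group_mult wclass_eq_iff pres_eq_winv_left)
  then show "\<exists>B\<in>carrier (presented_group R).
      B \<otimes>\<^bsub>presented_group R\<^esub> A = \<one>\<^bsub>presented_group R\<^esub>"
    by (auto simp: presented_group_def)
next
  show "\<one>\<^bsub>presented_group R\<^esub> \<in> carrier (presented_group R)"
    by (simp add: presented_group_def)
next
  fix A B assume "A \<in> carrier (presented_group R)" "B \<in> carrier (presented_group R)"
  then obtain u v where "A = wclass R u" "B = wclass R v"
    by (auto simp: presented_group_def)
  then have "A \<otimes>\<^bsub>presented_group R\<^esub> B = wclass R (u @ v)"
    by (simp add: presented_group_mult)
  then show "A \<otimes>\<^bsub>presented_group R\<^esub> B \<in> carrier (presented_group R)"
    by (simp add: presented_group_def)
next
  fix A B C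
  assume "A \<in> carrier (presented_group R)" "B \<in> carrier (presented_group R)"
    "C \<in> carrier (presented_group R)"
  then obtain u v w where "A = wclass R u" "B = wclass R v" "C = wclass R w"
    by (auto simp: presented_group_def)
  then show "A \<otimes>\<^bsub>presented_group R\<^esub> B \<otimes>\<^bsub>presented_group R\<^esub> C =
      A \<otimes>\<^bsub>presented_group R\<^esub> (B \<otimes>\<^bsub>presented_group R\<^esub> C)"
    by (simp add: presented_group_mult)
qed

subsection \<open>The universal property\<close>

primrec weval :: "('a, 'm) monoid_scheme \<Rightarrow> ('g \<Rightarrow> 'a) \<Rightarrow> 'g letters \<Rightarrow> 'a" where
  "weval H f [] = \<one>\<^bsub>H\<^esub>"
| "weval H f (l # w) =
     (if snd l then f (fst l) else inv\<^bsub>H\<^esub> f (fst l)) \<otimes>\<^bsub>H\<^esub> weval H f w"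

lemma (in group) weval_closed:
  assumes "\<And>a. f a \<in> carrier G"
  shows "weval G f w \<in> carrier G"
  by (induction w) (use assms in auto)

lemma (in group) weval_append:
  assumes "\<And>a. f a \<in> carrier G"
  shows "weval G f (u @ v) = weval G f u \<otimes> weval G f v"
  by (induction u) (use assms weval_closed[of f, OF assms] in \<open>auto simp: m_assoc\<close>)

lemma (in group) weval_pres_eq:
  assumes f: "\<And>a. f a \<in> carrier G"
    and rels: "\<And>u v. (u, v) \<in> R \<Longrightarrow> weval G f u = weval G f v"
    and "pres_eq R u v"
  shows "weval G f u = weval G f v"
  using assms(3)
proof induction
  case (cancel a s)
  show ?case using f[of a] by (cases s) auto
qed (auto simp: rels weval_append[of f, OF f])

lemma (in group) presented_group_universal:
  assumes f: "\<And>a. f a \<in> carrier G"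
    and rels: "\<And>u v. (u, v) \<in> R \<Longrightarrow> weval G f u = weval G f v"
  shows "\<exists>h \<in> hom (presented_group R) G. \<forall>a. h (wclass R (gen a)) = f a"
proof
  let ?h = "\<lambda>A. weval G f (SOME u. u \<in> A)"
  have h: "?h (wclass R u) = weval G f u" for u
  proof -
    have "u \<in> wclass R u"
      by (simp add: wclass_def pres_eq.refl)
    then have "(SOME v. v \<in> wclass R u) \<in> wclass R u"
      by (rule someI)
    then have "pres_eq R u (SOME v. v \<in> wclass R u)"
      by (simp add: wclass_def)
    from weval_pres_eq[of f, OF f rels this] show ?thesis
      by simp
  qed
  show "\<forall>a. ?h (wclass R (gen a)) = f a"
    by (simp add: h) (simp add: gen_def f)
  show "?h \<in> hom (presented_group R) G"
  proof (rule homI)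
    fix A assume "A \<in> carrier (presented_group R)"
    then show "?h A \<in> carrier G"
      by (simp add: weval_closed[of f, OF f])
  next
    fix A B assume "A \<in> carrier (presented_group R)" "B \<in> carrier (presented_group R)"
    then obtain u v where "A = wclass R u" "B = wclass R v"
      by (auto simp: presented_group_def)
    then show "?h (A \<otimes>\<^bsub>presented_group R\<^esub> B) = ?h A \<otimes> ?h B"
      by (simp add: presented_group_mult h weval_append[of f, OF f])
  qed
qed

section \<open>Beauville structures\<close>

definition beauville_Sigma :: "('a, 'm) monoid_scheme \<Rightarrow> 'a \<Rightarrow> 'a \<Rightarrow> 'a set" where
  "beauville_Sigma G x y =
     (\<Union>i\<in>{1..order G}. \<Union>g\<in>carrier G.
        {g \<otimes>\<^bsub>G\<^esub> (x [^]\<^bsub>G\<^esub> (i::nat)) \<otimes>\<^bsub>G\<^esub> inv\<^bsub>G\<^esub> g,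
         g \<otimes>\<^bsub>G\<^esub> (y [^]\<^bsub>G\<^esub> i) \<otimes>\<^bsub>G\<^esub> inv\<^bsub>G\<^esub> g,
         g \<otimes>\<^bsub>G\<^esub> ((x \<otimes>\<^bsub>G\<^esub> y) [^]\<^bsub>G\<^esub> i) \<otimes>\<^bsub>G\<^esub> inv\<^bsub>G\<^esub> g})"

definition beauville_structure :: "('a, 'm) monoid_scheme \<Rightarrow> ('a \<times> 'a) set \<Rightarrow> bool" where
  "beauville_structure G S \<longleftrightarrow>
     (\<exists>x1 y1 x2 y2. S = {(x1, y1), (x2, y2)} \<and>
        x1 \<in> carrier G \<and> y1 \<in> carrier G \<and> x2 \<in> carrier G \<and> y2 \<in> carrier G \<and>
        generate G {x1, y1} = carrier G \<and> generate G {x2, y2} = carrier G \<and>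
        beauville_Sigma G x1 y1 \<inter> beauville_Sigma G x2 y2 = {\<one>\<^bsub>G\<^esub>})"

definition beauville_group :: "('a, 'm) monoid_scheme \<Rightarrow> bool" where
  "beauville_group G \<longleftrightarrow>
     group G \<and> finite (carrier G) \<and> (\<exists>S. beauville_structure G S)"

text \<open>One automorphism serves both pairs, while the conjugating element may depend on the pair.\<close>

definition strongly_real :: "('a, 'm) monoid_scheme \<Rightarrow> ('a \<times> 'a) set \<Rightarrow> bool" where
  "strongly_real G S \<longleftrightarrow>
     (\<exists>\<phi>\<in>auto G. \<forall>(x, y)\<in>S. \<exists>g\<in>carrier G.
        g \<otimes>\<^bsub>G\<^esub> \<phi> x \<otimes>\<^bsub>G\<^esub> inv\<^bsub>G\<^esub> g = inv\<^bsub>G\<^esub> x \<and>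
        g \<otimes>\<^bsub>G\<^esub> \<phi> y \<otimes>\<^bsub>G\<^esub> inv\<^bsub>G\<^esub> g = inv\<^bsub>G\<^esub> y)"

definition purely_strongly_real_beauville_group :: "('a, 'm) monoid_scheme \<Rightarrow> bool" where
  "purely_strongly_real_beauville_group G \<longleftrightarrow>
     beauville_group G \<and> (\<forall>S. beauville_structure G S \<longrightarrow> strongly_real G S)"

section \<open>The groups under consideration\<close>

datatype xyz = GX | GY | GZ

definition xyz_relations :: "nat \<Rightarrow> nat \<Rightarrow> nat \<Rightarrow> (xyz letters \<times> xyz letters) set" where
  "xyz_relations p n r =
     {(wpow (gen GX) (p ^ n), []),
      (wpow (gen GY) (p ^ n), []),
      (wpow (gen GZ) (p ^ r), []),
      (wcomm (gen GX) (gen GY), gen GZ),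
      (wcomm (gen GX) (gen GZ), []),
      (wcomm (gen GY) (gen GZ), [])}"

end

theory Submission
  imports Defs "HOL-Algebra.Multiplicative_Group" "HOL-Number_Theory.Cong"
begin

text \<open>
  Sending a triple \<open>(a, b, c)\<close> to \<open>x\<^sup>a y\<^sup>b z\<^sup>c\<close> identifies the group with the integral Heisenberg group
  modulo the triples with \<open>p\<^sup>n\<close> dividing \<open>a\<close> and \<open>b\<close> and \<open>p\<^sup>r\<close> dividing \<open>c\<close>; a group of triples of
  residues shows that the presentation causes no further collapse.  A generating pair has a
  determinant in the abelianization that is a unit modulo \<open>p\<close>.  The
  automorphism \<open>x \<mapsto> x\<^sup>-\<^sup>1\<close>, \<open>y \<mapsto> y\<^sup>-\<^sup>1\<close> inverts every element up to the centre, and for both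
  members of a generating pair the central errors can be removed by one conjugation, because this amounts to
  solving a linear system with that determinant.  So one automorphism serves all generating pairs.
  Powers of elements on different lines of the abelianization modulo \<open>p\<close> are conjugate only if
  trivial, so a Beauville structure only needs six distinct lines, which exist as \<open>p + 1 \<ge> 6\<close>.
\<close>

section \<open>Quotients of the integral Heisenberg group\<close>

text \<open>A homomorphism from the integers is determined by its value at 1. This gives integer
  powers of the coordinate elements, and later powers of a conjugate.\<close>

lemma (in group) additive_eq_int_pow:
  fixes f :: "int \<Rightarrow> 'a"
  assumes closed: "\<And>i. f i \<in> carrier G"
    and add: "\<And>i j. f (i + j) = f i \<otimes> f j"
  shows "f 1 [^] i = f i"
proof -
  have zero: "f 0 = \<one>"
    using add[of 0 0] closed[of 0] by (simp add: l_cancel_one')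
  show ?thesis
  proof (induction i rule: int_induct[where k = 0])
    case base
    show ?case by (simp add: zero)
  next
    case (step1 i)
    then show ?case by (simp add: int_pow_mult closed add)
  next
    case (step2 i)
    have "f (- 1) \<otimes> f 1 = \<one>"
      using add[of "- 1" 1] by (simp add: zero)
    then have "inv f 1 = f (- 1)"
      by (simp add: inv_equality closed)
    then have "f 1 [^] (i + - 1) = f i \<otimes> f (- 1)"
      unfolding int_pow_mult[OF closed] using step2 by (simp add: int_pow_neg closed)
    then show ?case using add[of i "- 1"] by simp
  qed
qed

text \<open>
  The map \<open>N\<close> is the projection of the integral Heisenberg group onto its quotient by the triples
  in \<open>M\<int> \<times> M\<int> \<times> K\<int>\<close>; the term \<open>- b * a'\<close> reflects
  \<open>y x = x y z\<^sup>-\<^sup>1\<close>.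
\<close>

locale heisenberg_cover = group G for G (structure) +
  fixes N :: "int \<Rightarrow> int \<Rightarrow> int \<Rightarrow> 'a" and M K :: nat
  assumes carrier_eq: "carrier G = {N a b c |a b c. True}"
    and N_mult: "N a b c \<otimes> N a' b' c' = N (a + a') (b + b') (c + c' - b * a')"
    and N_eq_iff: "N a b c = N a' b' c' \<longleftrightarrow>
      [a = a'] (mod int M) \<and> [b = b'] (mod int M) \<and> [c = c'] (mod int K)"
    and K_dvd_M: "K dvd M"
    and M_pos: "M > 0"
begin

lemma N_closed [simp]: "N a b c \<in> carrier G"
  by (auto simp: carrier_eq)

lemma carrierE:
  assumes "g \<in> carrier G"
  obtains a b c where "g = N a b c"
  using assms by (auto simp: carrier_eq)

lemma K_pos: "K > 0"
  using K_dvd_M M_pos by (auto intro: dvd_pos_nat)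

lemma N_zero: "N 0 0 0 = \<one>"
  using N_mult[of 0 0 0 0 0 0] by (simp add: l_cancel_one')

lemma inv_N: "inv N a b c = N (- a) (- b) (- c - a * b)"
  by (rule inv_equality) (simp_all add: N_mult N_zero algebra_simps)

text \<open>Commutators are central, so only the third coordinate moves, by the determinant of
  \<open>(s, t)\<close> and \<open>(a, b)\<close>.\<close>

lemma conj_N: "N s t q \<otimes> N a b c \<otimes> inv N s t q = N a b (c + s * b - t * a)"
proof -
  have "N s t q \<otimes> N a b c = N a b (c + s * b - t * a) \<otimes> N s t q"
    by (simp add: N_mult algebra_simps)
  then show ?thesis
    by (simp add: m_assoc)
qed

lemma N_int_pow:
  "N 1 0 0 [^] (i::int) = N i 0 0"
  "N 0 1 0 [^] (i::int) = N 0 i 0"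
  "N 0 0 1 [^] (i::int) = N 0 0 i"
  by (rule additive_eq_int_pow[of "\<lambda>i. N i 0 0"] additive_eq_int_pow[of "\<lambda>i. N 0 i 0"]
      additive_eq_int_pow[of "\<lambda>i. N 0 0 i"]; simp add: N_mult)+

text \<open>Collecting the factors moves a \<open>b\<close>-part past a later \<open>a\<close>-part
  once for each pair of factors, whence the binomial coefficient.\<close>

lemma N_pow:
  "N a b c [^] (i::nat) =
     N (int i * a) (int i * b) (int i * c - a * b * int (i choose 2))"
proof (induction i)
  case 0
  show ?case by (simp add: N_zero numeral_2_eq_2)
next
  case (Suc i)
  have "Suc i choose 2 = i + (i choose 2)"
    by (simp add: numeral_2_eq_2)
  then show ?case
    by (simp add: Suc N_mult algebra_simps)
qed

end

section \<open>Conjugate powers and disjointness of the sets Sigma\<close>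

text \<open>Coprimality to 6 is the form in which \<open>p \<ge> 5\<close> is used: 2 and 3 become
  units modulo \<open>M\<close>.\<close>

locale heisenberg_cover_6 = heisenberg_cover +
  assumes coprime_M_6: "coprime M 6"
begin

lemma odd_M: "odd M"
proof
  assume "even M"
  then have "2 dvd gcd M 6" by simp
  then show False using coprime_M_6 by simp
qed

text \<open>This relies on \<open>M\<close> dividing \<open>M choose 2\<close>, which needs \<open>M\<close> odd.\<close>

lemma N_pow_eq_one:
  assumes "M dvd i"
  shows "N a b c [^] i = \<one>"
proof -
  have "M choose 2 = M * ((M - 1) div 2)"
    using odd_M by (simp add: choose_two div_mult_swap)
  then have "M dvd M choose 2" by simp
  then have "int K dvd int (M choose 2)" "int K dvd int M"
    using K_dvd_M by (meson dvd_trans int_dvd_int_iff)+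
  then have "N a b c [^] M = \<one>"
    by (simp add: N_pow N_zero[symmetric] N_eq_iff cong_0_iff)
  then show ?thesis
    using assms by (auto simp: nat_pow_pow[symmetric])
qed

lemma finite_carrier: "finite (carrier G)"
proof (rule finite_subset)
  show "carrier G \<subseteq> (\<lambda>(a, b, c). N a b c) ` ({0..<int M} \<times> {0..<int M} \<times> {0..<int K})"
  proof
    fix g assume "g \<in> carrier G"
    then obtain a b c where "g = N a b c" by (rule carrierE)
    then have "g = N (a mod int M) (b mod int M) (c mod int K)"
      by (simp add: N_eq_iff)
    then show "g \<in> (\<lambda>(a, b, c). N a b c) ` ({0..<int M} \<times> {0..<int M} \<times> {0..<int K})"
      using M_pos K_pos by (intro image_eqI[of _ _ "(a mod int M, b mod int M, c mod int K)"]) auto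
  qed
qed auto

text \<open>Conjugation fixes the first two coordinates, so \<open>i\<close> times
  \<open>(a, b)\<close> is congruent to \<open>j\<close> times \<open>(a', b')\<close>. Eliminating
  \<open>j\<close> leaves \<open>i\<close> times the determinant, hence \<open>M\<close> divides
  \<open>i\<close>.\<close>

lemma conj_pow_eq_one:
  assumes "coprime (int M) (a * b' - a' * b)"
    and g: "g \<in> carrier G" and h: "h \<in> carrier G"
    and eq: "g \<otimes> N a b c [^] (i::nat) \<otimes> inv g = h \<otimes> N a' b' c' [^] (j::nat) \<otimes> inv h"
  shows "g \<otimes> N a b c [^] i \<otimes> inv g = \<one>"
proof -
  obtain s t q where g': "g = N s t q" using g by (rule carrierE)
  obtain s' t' q' where h': "h = N s' t' q'" using h by (rule carrierE)
  from eq have "[int i * a = int j * a'] (mod int M)" "[int i * b = int j * b'] (mod int M)"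
    by (simp_all add: g' h' N_pow conj_N N_eq_iff)
  then have "int M dvd int i * a - int j * a'" "int M dvd int i * b - int j * b'"
    by (simp_all add: cong_iff_dvd_diff)
  then have "int M dvd (int i * a - int j * a') * b' - (int i * b - int j * b') * a'"
    by (rule dvd_diff[OF dvd_mult2 dvd_mult2])
  also have "\<dots> = int i * (a * b' - a' * b)"
    by (simp add: algebra_simps)
  finally have "int M dvd int i"
    using assms(1) by (simp only: coprime_dvd_mult_left_iff)
  then show ?thesis
    using g by (simp add: N_pow_eq_one)
qed

lemma one_in_Sigma:
  assumes "u \<in> carrier G"
  shows "\<one> \<in> beauville_Sigma G u v"
proof -
  \<comment> \<open>Exponents in \<open>beauville_Sigma\<close> start at 1, so the identity is
    obtained from the exponent \<open>order G\<close>.\<close>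
  have order: "order G \<in> {1..order G}"
    using finite_carrier order_gt_0_iff_finite by (simp add: Suc_leI)
  have "\<one> = \<one> \<otimes> u [^] order G \<otimes> inv \<one>"
    using assms by (simp add: pow_order_eq_1)
  then show ?thesis
    unfolding beauville_Sigma_def by (intro UN_I[OF order] UN_I[OF one_closed]) auto
qed

lemma Sigma_inter:
  assumes "\<And>a b c a' b' c'. N a b c \<in> {u, v, u \<otimes> v} \<Longrightarrow> N a' b' c' \<in> {u', v', u' \<otimes> v'} \<Longrightarrow>
      coprime (int M) (a * b' - a' * b)"
    and carr: "u \<in> carrier G" "v \<in> carrier G" "u' \<in> carrier G" "v' \<in> carrier G"
  shows "beauville_Sigma G u v \<inter> beauville_Sigma G u' v' = {\<one>}"
proof -
  have "k = \<one>" if k: "k \<in> beauville_Sigma G u v" "k \<in> beauville_Sigma G u' v'" for k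
  proof -
    obtain g and i :: nat and w where w: "g \<in> carrier G" "w \<in> {u, v, u \<otimes> v}"
        "k = g \<otimes> w [^] i \<otimes> inv g"
      using k(1) by (auto simp: beauville_Sigma_def)
    obtain h and j :: nat and w' where w': "h \<in> carrier G" "w' \<in> {u', v', u' \<otimes> v'}"
        "k = h \<otimes> w' [^] j \<otimes> inv h"
      using k(2) by (auto simp: beauville_Sigma_def)
    have "w \<in> carrier G" "w' \<in> carrier G"
      using w(2) w'(2) carr by auto
    then obtain a b c a' b' c' where N: "w = N a b c" "w' = N a' b' c'"
      by (metis carrierE)
    then have "coprime (int M) (a * b' - a' * b)"
      using assms(1) w(2) w'(2) by metis
    then show ?thesis
      using conj_pow_eq_one w w' N by metis
  qed
  then show ?thesis
    using one_in_Sigma carr by blast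
qed

section \<open>Two generating pairs and a Beauville structure\<close>

lemma subgroup_eq_carrier:
  assumes H: "subgroup H G" and x: "N 1 0 0 \<in> H" and y: "N 0 1 0 \<in> H"
  shows "H = carrier G"
proof
  interpret H: subgroup H G by (rule H)
  show "H \<subseteq> carrier G" by (rule H.subset)
  show "carrier G \<subseteq> H"
  proof
    fix g assume "g \<in> carrier G"
    then obtain a b c where g: "g = N a b c" by (rule carrierE)
    have z: "N 0 0 1 \<in> H"
    proof -
      have "N 0 0 1 = N 1 0 0 \<otimes> N 0 1 0 \<otimes> inv N 1 0 0 \<otimes> inv N 0 1 0"
        by (simp add: conj_N) (simp add: inv_N N_mult)
      then show ?thesis using x y by simp
    qed
    have "N a 0 0 \<in> H" "N 0 b 0 \<in> H" "N 0 0 c \<in> H"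
      using x y z subgroup_int_pow_closed[OF H] N_int_pow by metis+
    moreover have "g = N a 0 0 \<otimes> N 0 b 0 \<otimes> N 0 0 c"
      by (simp add: g N_mult)
    ultimately show "g \<in> H" by simp
  qed
qed

lemma generate_standard: "generate G {N 1 0 0, N 0 1 0} = carrier G"
  by (rule subgroup_eq_carrier) (auto intro: generate_is_subgroup generate.incl)

lemma generate_second: "generate G {N 1 2 0, N 1 4 0} = carrier G"
proof (rule subgroup_eq_carrier)
  let ?H = "generate G {N 1 2 0, N 1 4 0}"
  show H: "subgroup ?H G" by (rule generate_is_subgroup) simp
  interpret H: subgroup ?H G by (rule H)
  have gens: "N 1 2 0 \<in> ?H" "N 1 4 0 \<in> ?H" by (auto intro: generate.incl)
  have "inv N 1 2 0 \<otimes> N 1 4 0 = N 0 2 0"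
    by (simp add: inv_N N_mult)
  then have y2: "N 0 2 0 \<in> ?H"
    using gens by (metis H.m_closed H.m_inv_closed)
  \<comment> \<open>Since \<open>M\<close> is odd, \<open>(M + 1) div 2\<close> is an inverse of 2
    modulo \<open>M\<close>.\<close>
  have "N 0 2 0 [^] ((M + 1) div 2) = N 0 (int ((M + 1) div 2) * 2) 0"
    by (simp add: N_pow)
  also have "int ((M + 1) div 2) * 2 = int M + 1"
    using odd_M by presburger
  also have "N 0 (int M + 1) 0 = N 0 1 0"
    by (simp add: N_eq_iff cong_iff_dvd_diff)
  finally show "N 0 1 0 \<in> ?H"
    using y2 subgroup_int_pow_closed[OF H] int_pow_int by metis
  have "N 1 2 0 \<otimes> inv N 0 2 0 = N 1 0 0"
    by (simp add: inv_N N_mult)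
  then show "N 1 0 0 \<in> ?H"
    using gens y2 by (metis H.m_closed H.m_inv_closed)
qed

text \<open>
  Modulo a prime \<open>p \<ge> 5\<close> the six lines spanned by \<open>(1,0)\<close>, \<open>(0,1)\<close>, \<open>(1,1)\<close> and
  \<open>(1,2)\<close>, \<open>(1,4)\<close>, \<open>(2,6)\<close> are distinct: all determinants below have prime factors 2 and 3 only.
\<close>

lemma beauville_structure_exists:
  "beauville_structure G {(N 1 0 0, N 0 1 0), (N 1 2 0, N 1 4 0)}"
proof -
  have M6: "coprime (int M) 6"
    using coprime_M_6 by (metis coprime_int_iff of_nat_numeral)
  have "coprime (int M) (2 * 3)" using M6 by simp
  then have M: "coprime (int M) 2" "coprime (int M) 3"
    unfolding coprime_mult_right_iff by auto
  have M4: "coprime (int M) 4"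
    using M(1) coprime_mult_right_iff[of "int M" 2 2] by simp
  have "coprime (int M) (a * b' - a' * b)"
    if "N a b c \<in> {N 1 0 0, N 0 1 0, N 1 0 0 \<otimes> N 0 1 0}"
      and "N a' b' c' \<in> {N 1 2 0, N 1 4 0, N 1 2 0 \<otimes> N 1 4 0}" for a b c a' b' c'
  proof -
    have 1: "\<exists>(d, e)\<in>{(1, 0), (0, 1), (1, 1)}. [a = d] (mod int M) \<and> [b = e] (mod int M)"
      using that(1) by (auto simp: N_mult N_eq_iff)
    have 2: "\<exists>(d, e)\<in>{(1, 2), (1, 4), (2, 6)}. [a' = d] (mod int M) \<and> [b' = e] (mod int M)"
      using that(2) by (auto simp: N_mult N_eq_iff)
    obtain d e d' e' where de: "(d, e) \<in> {(1, 0), (0, 1), (1, 1)}"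
        "(d', e') \<in> {(1, 2), (1, 4), (2, 6)}"
      and cong: "[a = d] (mod int M)" "[b = e] (mod int M)"
        "[a' = d'] (mod int M)" "[b' = e'] (mod int M)"
      using 1 2 by blast
    have "[a * b' - a' * b = d * e' - d' * e] (mod int M)"
      by (intro cong_diff cong_mult cong)
    moreover have "coprime (int M) (d * e' - d' * e)"
      using de M M4 M6 by auto
    ultimately show ?thesis
      using cong_imp_coprime cong_sym coprime_commute by blast
  qed
  then have "beauville_Sigma G (N 1 0 0) (N 0 1 0) \<inter> beauville_Sigma G (N 1 2 0) (N 1 4 0) = {\<one>}"
    by (intro Sigma_inter) auto
  then show ?thesis
    unfolding beauville_structure_def
    using generate_standard generate_second N_closed by blast
qed

section \<open>Strong reality of all generating pairs\<close>

text \<open>In the first two coordinates a generating pair spans the standard basis over the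
  integers modulo \<open>M\<close>. The matrix expressing that basis has a determinant inverse to
  the given one.\<close>

lemma generate_imp_det_unit:
  assumes gen: "generate G {N a b c, N a' b' c'} = carrier G"
  shows "\<exists>D. [(a * b' - a' * b) * D = 1] (mod int M)"
proof -
  have comb: "\<exists>i j d. g = N (i * a + j * a') (i * b + j * b') d"
    if "g \<in> generate G {N a b c, N a' b' c'}" for g
    using that
  proof induction
    case one
    have "\<one> = N (0 * a + 0 * a') (0 * b + 0 * b') 0" by (simp add: N_zero)
    then show ?case by blast
  next
    case (incl h)
    have "N a b c = N (1 * a + 0 * a') (1 * b + 0 * b') c"
      "N a' b' c' = N (0 * a + 1 * a') (0 * b + 1 * b') c'" by simp_all
    then show ?case using incl by blast
  next
    case (inv h)
    have "inv N a b c = N ((- 1) * a + 0 * a') ((- 1) * b + 0 * b') (- c - a * b)"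
      "inv N a' b' c' = N (0 * a + (- 1) * a') (0 * b + (- 1) * b') (- c' - a' * b')"
      by (simp_all add: inv_N)
    then show ?case using inv by blast
  next
    case (eng g h)
    then obtain i j d i' j' d' where "g = N (i * a + j * a') (i * b + j * b') d"
      "h = N (i' * a + j' * a') (i' * b + j' * b') d'" by blast
    then have "g \<otimes> h = N ((i + i') * a + (j + j') * a') ((i + i') * b + (j + j') * b')
        (d + d' - (i * b + j * b') * (i' * a + j' * a'))"
      by (simp add: N_mult algebra_simps)
    then show ?case by blast
  qed
  obtain i j d where "N 1 0 0 = N (i * a + j * a') (i * b + j * b') d"
    using comb gen N_closed by metis
  moreover obtain k l d' where "N 0 1 0 = N (k * a + l * a') (k * b + l * b') d'"
    using comb gen N_closed by metis
  ultimately have "[(i * a + j * a') * (k * b + l * b') - (i * b + j * b') * (k * a + l * a')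
      = 1 * 1 - 0 * 0] (mod int M)"
    unfolding N_eq_iff by (intro cong_diff cong_mult) (auto intro: cong_sym)
  \<comment> \<open>Multiplicativity of the 2 by 2 determinant.\<close>
  moreover have "(i * a + j * a') * (k * b + l * b') - (i * b + j * b') * (k * a + l * a') =
      (a * b' - a' * b) * (i * l - j * k)"
    by (simp add: algebra_simps)
  ultimately have "[(a * b' - a' * b) * (i * l - j * k) = 1] (mod int M)"
    by simp
  then show ?thesis by blast
qed

text \<open>An element has many coordinate triples, so one is chosen; the restriction to the carrier
  is there because members of \<open>auto G\<close> are extensional.\<close>

definition \<theta> :: "'a \<Rightarrow> 'a" where
  "\<theta> = (\<lambda>g\<in>carrier G. SOME h. \<exists>a b c. g = N a b c \<and> h = N (- a) (- b) c)"

lemma \<theta>_N: "\<theta> (N a b c) = N (- a) (- b) c"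
proof -
  have "\<exists>a' b' c'. N a b c = N a' b' c' \<and> \<theta> (N a b c) = N (- a') (- b') c'"
    unfolding \<theta>_def restrict_apply'[OF N_closed] by (rule someI) blast
  then show ?thesis
    by (auto simp: N_eq_iff cong_minus_minus_iff intro: cong_sym)
qed

text \<open>The product \<open>b * a'\<close> in the multiplication law is unchanged when both signs
  flip. Bijectivity holds because the map is an involution.\<close>

lemma \<theta>_auto: "\<theta> \<in> auto G"
proof -
  have closed: "\<theta> g \<in> carrier G" and invol: "\<theta> (\<theta> g) = g" if "g \<in> carrier G" for g
    using that by (auto elim!: carrierE simp: \<theta>_N)
  have "bij_betw \<theta> (carrier G) (carrier G)"
    by (rule bij_betw_byWitness[where f' = \<theta>]) (auto simp: closed invol)
  moreover have "\<theta> \<in> extensional (carrier G)"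
    by (simp add: \<theta>_def)
  moreover have "\<theta> \<in> hom G G"
    by (rule homI) (auto simp: closed \<theta>_N N_mult elim!: carrierE)
  ultimately show ?thesis
    by (simp add: auto_def Bij_def)
qed

text \<open>
  Conjugation by \<open>N s t 0\<close> shifts the third coordinate of \<open>N a b c\<close> by \<open>s * b - t * a\<close>, so the
  conjugating element is found by solving two linear equations with Cramer's rule.
\<close>

lemma \<theta>_conj_inverse:
  assumes "u \<in> carrier G" "v \<in> carrier G" and gen: "generate G {u, v} = carrier G"
  shows "\<exists>g\<in>carrier G. g \<otimes> \<theta> u \<otimes> inv g = inv u \<and> g \<otimes> \<theta> v \<otimes> inv g = inv v"
proof -
  obtain a b c where u: "u = N a b c" using assms(1) by (rule carrierE)
  obtain a' b' c' where v: "v = N a' b' c'" using assms(2) by (rule carrierE)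
  define \<delta> where "\<delta> = a * b' - a' * b"
  obtain D where "[\<delta> * D = 1] (mod int M)"
    using generate_imp_det_unit[of a b c a' b' c'] gen by (auto simp: u v \<delta>_def)
  then have D: "int K dvd \<delta> * D - 1"
    using K_dvd_M by (meson cong_iff_dvd_diff dvd_trans int_dvd_int_iff)
  \<comment> \<open>These are the differences of the third coordinates of \<open>\<theta> u\<close>
    and \<open>inv u\<close>, and of \<open>\<theta> v\<close> and \<open>inv v\<close>. The system
    is \<open>s * b - t * a = e\<close>, \<open>s * b' - t * a' = e'\<close> modulo
    \<open>K\<close>, and \<open>D\<close> replaces division by \<open>\<delta>\<close>.\<close>
  define e e' where "e = 2 * c + a * b" and "e' = 2 * c' + a' * b'"
  define s t where "s = D * (e' * a - e * a')" and "t = D * (e' * b - e * b')"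
  have "c + s * - b - t * - a - (- c - a * b) = (\<delta> * D - 1) * (- e)"
    "c' + s * - b' - t * - a' - (- c' - a' * b') = (\<delta> * D - 1) * (- e')"
    by (simp_all add: s_def t_def e_def e'_def \<delta>_def algebra_simps)
  then have "[c + s * - b - t * - a = - c - a * b] (mod int K)"
    "[c' + s * - b' - t * - a' = - c' - a' * b'] (mod int K)"
    unfolding cong_iff_dvd_diff using D by (metis dvd_mult2)+
  then show ?thesis
    by (intro bexI[of _ "N s t 0"])
      (simp_all add: u v \<theta>_N conj_N inv_N[of a b c] inv_N[of a' b' c'] N_eq_iff)
qed

theorem purely_strongly_real: "purely_strongly_real_beauville_group G"
  unfolding purely_strongly_real_beauville_group_def beauville_group_def
proof (intro conjI allI impI)
  fix S assume "beauville_structure G S"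
  then have "\<exists>g\<in>carrier G. g \<otimes> \<theta> u \<otimes> inv g = inv u \<and> g \<otimes> \<theta> v \<otimes> inv g = inv v"
    if "(u, v) \<in> S" for u v
    using that \<theta>_conj_inverse by (auto simp: beauville_structure_def)
  then show "strongly_real G S"
    unfolding strongly_real_def using \<theta>_auto by blast
qed (use is_group finite_carrier beauville_structure_exists in auto)

end

section \<open>The presented group\<close>

definition heis_model :: "nat \<Rightarrow> nat \<Rightarrow> (int \<times> int \<times> int) monoid" where
  "heis_model M K =
     \<lparr>carrier = {0..<int M} \<times> {0..<int M} \<times> {0..<int K},
      monoid.mult = (\<lambda>(a, b, c) (a', b', c').
        ((a + a') mod int M, (b + b') mod int M, (c + c' - b * a') mod int K)),
      monoid.one = (0, 0, 0)\<rparr>"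

definition heis_rep :: "nat \<Rightarrow> nat \<Rightarrow> int \<Rightarrow> int \<Rightarrow> int \<Rightarrow> int \<times> int \<times> int" where
  "heis_rep M K a b c = (a mod int M, b mod int M, c mod int K)"

lemma heis_rep_closed:
  assumes "M > 0" "K > 0"
  shows "heis_rep M K a b c \<in> carrier (heis_model M K)"
  using assms by (simp add: heis_rep_def heis_model_def)

lemma heis_model_elem:
  assumes "g \<in> carrier (heis_model M K)"
  obtains a b c where "g = heis_rep M K a b c"
proof -
  obtain a b c where "g = (a, b, c)" by (cases g)
  then have "g = heis_rep M K a b c"
    using assms by (auto simp: heis_model_def heis_rep_def)
  then show thesis by (rule that)
qed

text \<open>Because \<open>K\<close> divides \<open>M\<close>, residues modulo \<open>M\<close>
  determine the product \<open>b * a'\<close> modulo \<open>K\<close>.\<close>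

lemma heis_rep_mult:
  assumes "K dvd M"
  shows "heis_rep M K a b c \<otimes>\<^bsub>heis_model M K\<^esub> heis_rep M K a' b' c' =
    heis_rep M K (a + a') (b + b') (c + c' - b * a')"
proof -
  have "[b mod int M = b] (mod int K)" "[a' mod int M = a'] (mod int K)"
    using assms by (simp_all add: cong_def mod_mod_cancel)
  then have "[c mod int K + c' mod int K - (b mod int M) * (a' mod int M) = c + c' - b * a']
      (mod int K)"
    by (intro cong_diff cong_add cong_mult) auto
  then show ?thesis
    by (simp add: heis_rep_def heis_model_def mod_simps cong_def)
qed

lemma heis_model_one: "\<one>\<^bsub>heis_model M K\<^esub> = heis_rep M K 0 0 0"
  by (simp add: heis_rep_def heis_model_def)

lemma group_heis_model:
  assumes "K dvd M" "M > 0"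
  shows "group (heis_model M K)"
proof -
  have "K > 0" using assms by (auto intro: dvd_pos_nat)
  note closed = heis_rep_closed[OF assms(2) this] and mult = heis_rep_mult[OF assms(1)]
  show ?thesis
  proof (rule groupI)
    fix g assume "g \<in> carrier (heis_model M K)"
    then obtain a b c where g: "g = heis_rep M K a b c" by (rule heis_model_elem)
    show "\<one>\<^bsub>heis_model M K\<^esub> \<otimes>\<^bsub>heis_model M K\<^esub> g = g"
      by (simp add: g mult heis_model_one)
    have "heis_rep M K (- a) (- b) (- c - a * b) \<otimes>\<^bsub>heis_model M K\<^esub> g = \<one>\<^bsub>heis_model M K\<^esub>"
      by (simp add: g mult heis_model_one algebra_simps)
    then show "\<exists>h\<in>carrier (heis_model M K). h \<otimes>\<^bsub>heis_model M K\<^esub> g = \<one>\<^bsub>heis_model M K\<^esub>"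
      using closed by blast
  qed (auto elim!: heis_model_elem simp: mult closed heis_model_one algebra_simps)
qed

lemma heisenberg_cover_model:
  assumes "K dvd M" "M > 0"
  shows "heisenberg_cover (heis_model M K) (heis_rep M K) M K"
proof -
  have "K > 0" using assms by (auto intro: dvd_pos_nat)
  then have "carrier (heis_model M K) = {heis_rep M K a b c |a b c. True}"
    using heis_rep_closed[OF assms(2)] by (blast elim: heis_model_elem)
  then show ?thesis
    using assms group_heis_model
    by (simp add: heisenberg_cover_def heisenberg_cover_axioms_def heis_rep_mult)
      (simp add: heis_rep_def cong_def)
qed

section \<open>Collecting powers from the commutator relations\<close>

text \<open>Here \<open>w\<close> is the commutator of \<open>u\<close> and \<open>v\<close>.
  Conjugation by \<open>u\<close> sends \<open>v\<close> to \<open>w \<otimes> v\<close>, and powers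
  of this product split because its factors commute.\<close>

lemma (in group) int_pow_twist:
  assumes carr: "u \<in> carrier G" "v \<in> carrier G" "w \<in> carrier G"
    and uv: "u \<otimes> v = w \<otimes> v \<otimes> u" and wv: "w \<otimes> v = v \<otimes> w"
  shows "u \<otimes> v [^] (b::int) = w [^] b \<otimes> v [^] b \<otimes> u"
proof -
  let ?f = "\<lambda>i::int. u \<otimes> v [^] i \<otimes> inv u"
  have "?f (i + j) = ?f i \<otimes> ?f j" for i j
  proof -
    have "?f i \<otimes> ?f j = u \<otimes> v [^] i \<otimes> (inv u \<otimes> u) \<otimes> v [^] j \<otimes> inv u"
      by (simp only: m_assoc carr m_closed inv_closed int_pow_closed)
    then show ?thesis
      using carr by (simp add: int_pow_mult m_assoc)
  qed
  then have "?f 1 [^] b = ?f b"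
    using carr by (intro additive_eq_int_pow) auto
  moreover have "?f 1 = w \<otimes> v"
    using carr uv by (simp add: m_assoc)
  ultimately have "u \<otimes> v [^] b \<otimes> inv u = w [^] b \<otimes> v [^] b"
    using int_pow_mult_distrib[OF wv] carr by simp
  then show ?thesis
    using carr by (metis inv_closed inv_solve_right int_pow_closed m_closed inv_inv)
qed

lemma (in group) int_pow_commute:
  assumes "u \<in> carrier G" "v \<in> carrier G" and "u \<otimes> v = v \<otimes> u"
  shows "u [^] (i::int) \<otimes> v [^] (j::int) = v [^] j \<otimes> u [^] i"
proof -
  have "v \<otimes> u [^] i = u [^] i \<otimes> v"
    using int_pow_twist[of v u \<one> i] assms by simp
  then show ?thesis
    using int_pow_twist[of "u [^] i" v \<one> j] assms by simp
qed

lemma (in group) heisenberg_mult: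
  fixes a b c a' b' c' :: int
  assumes carr: "x \<in> carrier G" "y \<in> carrier G" "z \<in> carrier G"
    and xy: "x \<otimes> y = z \<otimes> y \<otimes> x" and xz: "x \<otimes> z = z \<otimes> x" and yz: "y \<otimes> z = z \<otimes> y"
  shows "x [^] a \<otimes> y [^] b \<otimes> z [^] c \<otimes> (x [^] a' \<otimes> y [^] b' \<otimes> z [^] c') =
    x [^] (a + a') \<otimes> y [^] (b + b') \<otimes> z [^] (c + c' - b * a')"
proof -
  have xyb: "x \<otimes> y [^] b = z [^] b \<otimes> y [^] b \<otimes> x"
    by (rule int_pow_twist[OF carr xy yz[symmetric]])
  have "z [^] (- b) \<otimes> x \<otimes> y [^] b = z [^] (- b) \<otimes> z [^] b \<otimes> y [^] b \<otimes> x"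
    using carr xyb by (simp add: m_assoc)
  then have ybx: "y [^] b \<otimes> x = z [^] (- b) \<otimes> x \<otimes> y [^] b"
    using carr by (simp add: int_pow_neg)
  have "z [^] (- b) \<otimes> x = x \<otimes> z [^] (- b)"
    using int_pow_commute[OF carr(3,1) xz[symmetric], of "- b" 1] carr by simp
  \<comment> \<open>A second twist, now with \<open>y [^] b\<close> as the conjugating element and
    \<open>z [^] (- b)\<close> as the commutator.\<close>
  then have "y [^] b \<otimes> x [^] a' = (z [^] (- b)) [^] a' \<otimes> x [^] a' \<otimes> y [^] b"
    by (rule int_pow_twist[OF _ carr(1) _ ybx, rotated 2]) (use carr in auto)
  then have yx: "y [^] b \<otimes> x [^] a' = z [^] (- (b * a')) \<otimes> x [^] a' \<otimes> y [^] b"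
    using carr by (simp add: int_pow_pow)
  note zx = int_pow_commute[OF carr(3,1) xz[symmetric]]
  note zy = int_pow_commute[OF carr(3,2) yz[symmetric]]
  have "x [^] a \<otimes> y [^] b \<otimes> z [^] c \<otimes> (x [^] a' \<otimes> y [^] b' \<otimes> z [^] c') =
      x [^] a \<otimes> y [^] b \<otimes> (z [^] c \<otimes> x [^] a') \<otimes> y [^] b' \<otimes> z [^] c'"
    using carr by (simp add: m_assoc)
  also have "\<dots> = x [^] a \<otimes> (y [^] b \<otimes> x [^] a') \<otimes> (z [^] c \<otimes> y [^] b') \<otimes> z [^] c'"
    unfolding zx using carr by (simp add: m_assoc)
  also have "\<dots> = x [^] a \<otimes> (z [^] (- (b * a')) \<otimes> x [^] a') \<otimes> y [^] b \<otimes> y [^] b' \<otimes> z [^] c \<otimes> z [^] c'"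
    unfolding zy yx using carr by (simp add: m_assoc)
  also have "\<dots> = x [^] a \<otimes> x [^] a' \<otimes> (z [^] (- (b * a')) \<otimes> y [^] (b + b')) \<otimes> z [^] c \<otimes> z [^] c'"
    unfolding zx using carr by (simp add: m_assoc int_pow_mult)
  also have "\<dots> = x [^] (a + a') \<otimes> y [^] (b + b') \<otimes> z [^] (- (b * a') + c + c')"
    unfolding zy by (simp only: m_assoc int_pow_mult m_closed int_pow_closed carr)
  also have "- (b * a') + c + c' = c + c' - b * a'" by simp
  finally show ?thesis .
qed

lemma (in group) int_pow_cong:
  assumes "x \<in> carrier G" "x [^] m = \<one>" and "[i = j] (mod int m)"
  shows "x [^] i = x [^] j"
proof -
  obtain k where "i = j + int m * k"
    using assms(3) by (metis cong_iff_lin cong_sym)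
  moreover have "x [^] (int m * k) = \<one>"
    using assms by (simp add: int_pow_int flip: int_pow_pow)
  ultimately show ?thesis
    using assms(1) by (simp add: int_pow_mult)
qed

section \<open>Powers, inverses and commutators of words\<close>

lemma (in group) weval_wpow:
  assumes "\<And>a. f a \<in> carrier G"
  shows "weval G f (wpow w k) = weval G f w [^] k"
proof (induction k)
  case 0
  show ?case by (simp add: wpow_def)
next
  case (Suc k)
  have "weval G f (wpow w (Suc k)) = weval G f w \<otimes> weval G f w [^] k"
    using Suc by (simp add: wpow_def weval_append[OF assms])
  also have "\<dots> = weval G f w [^] Suc k"
    by (rule nat_pow_Suc2[symmetric]) (rule weval_closed[OF assms])
  finally show ?case .
qed

lemma wclass_wpow: "wclass R (wpow w k) = wclass R w [^]\<^bsub>presented_group R\<^esub> k"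
proof -
  interpret group "presented_group R" by (rule group_presented_group)
  have "wclass R w \<in> carrier (presented_group R)"
    by (simp add: presented_group_def)
  then show ?thesis
  proof (induction k)
    case 0
    show ?case by (simp add: wpow_def) (simp add: presented_group_def)
  next
    case (Suc k)
    have "wclass R (wpow w (Suc k)) =
        wclass R w \<otimes>\<^bsub>presented_group R\<^esub> wclass R w [^]\<^bsub>presented_group R\<^esub> k"
      using Suc by (simp add: wpow_def flip: presented_group_mult)
    also have "\<dots> = wclass R w [^]\<^bsub>presented_group R\<^esub> Suc k"
      by (rule nat_pow_Suc2[symmetric]) (rule Suc.prems)
    finally show ?case .
  qed
qed

lemma wclass_winv: "wclass R (winv w) = inv\<^bsub>presented_group R\<^esub> wclass R w"
proof -
  interpret group "presented_group R" by (rule group_presented_group)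
  have "wclass R (winv w) \<otimes>\<^bsub>presented_group R\<^esub> wclass R w = \<one>\<^bsub>presented_group R\<^esub>"
    by (simp add: presented_group_mult wclass_eq_iff pres_eq_winv_left)
      (simp add: presented_group_def wclass_eq_iff pres_eq_winv_left)
  then show ?thesis
    by (intro inv_equality[symmetric]) (simp_all add: presented_group_def)
qed

lemma wclass_wcomm:
  "wclass R (wcomm u v) = wclass R u \<otimes>\<^bsub>presented_group R\<^esub> wclass R v \<otimes>\<^bsub>presented_group R\<^esub>
    inv\<^bsub>presented_group R\<^esub> wclass R u \<otimes>\<^bsub>presented_group R\<^esub> inv\<^bsub>presented_group R\<^esub> wclass R v"
  by (simp add: wcomm_def presented_group_mult flip: wclass_winv)

section \<open>Identification of the presented group\<close>

text \<open>The relations bring every word to the form \<open>x^a y^b z^c\<close>; a homomorphism to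
  the residue model shows that incongruent exponents give different elements.\<close>

lemma heisenberg_cover_presented_group:
  fixes p n r :: nat
  assumes "p > 0" "r \<le> n"
  defines "P \<equiv> presented_group (xyz_relations p n r)"
    and "gcl \<equiv> \<lambda>a. wclass (xyz_relations p n r) (gen a)"
  shows "heisenberg_cover P
    (\<lambda>a b c. gcl GX [^]\<^bsub>P\<^esub> a \<otimes>\<^bsub>P\<^esub> gcl GY [^]\<^bsub>P\<^esub> b \<otimes>\<^bsub>P\<^esub> gcl GZ [^]\<^bsub>P\<^esub> c) (p ^ n) (p ^ r)"
    (is "heisenberg_cover _ ?N _ _")
proof -
  let ?R = "xyz_relations p n r" and ?M = "p ^ n" and ?K = "p ^ r"
  interpret P: group P unfolding P_def by (rule group_presented_group)
  have one: "wclass ?R [] = \<one>\<^bsub>P\<^esub>"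
    by (simp add: P_def presented_group_def)
  have carr: "wclass ?R w \<in> carrier P" for w
    by (simp add: P_def presented_group_def)
  have gcl [simp]: "gcl a \<in> carrier P" for a
    by (simp add: gcl_def carr)
  have rel: "wclass ?R u = wclass ?R v" if "(u, v) \<in> ?R" for u v
    using that by (simp add: wclass_eq_iff pres_eq.rel)
  have pows: "gcl GX [^]\<^bsub>P\<^esub> ?M = \<one>\<^bsub>P\<^esub>" "gcl GY [^]\<^bsub>P\<^esub> ?M = \<one>\<^bsub>P\<^esub>" "gcl GZ [^]\<^bsub>P\<^esub> ?K = \<one>\<^bsub>P\<^esub>"
    unfolding gcl_def P_def wclass_wpow[symmetric] one[unfolded P_def, symmetric]
    by (rule rel; simp add: xyz_relations_def)+
  have comms:
    "gcl GX \<otimes>\<^bsub>P\<^esub> gcl GY \<otimes>\<^bsub>P\<^esub> inv\<^bsub>P\<^esub> gcl GX \<otimes>\<^bsub>P\<^esub> inv\<^bsub>P\<^esub> gcl GY = gcl GZ"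
    "gcl GX \<otimes>\<^bsub>P\<^esub> gcl GZ \<otimes>\<^bsub>P\<^esub> inv\<^bsub>P\<^esub> gcl GX \<otimes>\<^bsub>P\<^esub> inv\<^bsub>P\<^esub> gcl GZ = \<one>\<^bsub>P\<^esub>"
    "gcl GY \<otimes>\<^bsub>P\<^esub> gcl GZ \<otimes>\<^bsub>P\<^esub> inv\<^bsub>P\<^esub> gcl GY \<otimes>\<^bsub>P\<^esub> inv\<^bsub>P\<^esub> gcl GZ = \<one>\<^bsub>P\<^esub>"
    unfolding gcl_def P_def wclass_wcomm[symmetric] one[unfolded P_def, symmetric]
    by (rule rel; simp add: xyz_relations_def)+
  have mult: "?N a b c \<otimes>\<^bsub>P\<^esub> ?N a' b' c' = ?N (a + a') (b + b') (c + c' - b * a')"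
    for a b c a' b' c'
  proof (rule P.heisenberg_mult)
    have comm: "u \<otimes>\<^bsub>P\<^esub> v = w \<otimes>\<^bsub>P\<^esub> v \<otimes>\<^bsub>P\<^esub> u"
      if "u \<otimes>\<^bsub>P\<^esub> v \<otimes>\<^bsub>P\<^esub> inv\<^bsub>P\<^esub> u \<otimes>\<^bsub>P\<^esub> inv\<^bsub>P\<^esub> v = w" "u \<in> carrier P" "v \<in> carrier P" for u v w
      using that by (auto simp: P.m_assoc)
    show "gcl GX \<otimes>\<^bsub>P\<^esub> gcl GY = gcl GZ \<otimes>\<^bsub>P\<^esub> gcl GY \<otimes>\<^bsub>P\<^esub> gcl GX"
      by (rule comm[OF comms(1)]) auto
    show "gcl GX \<otimes>\<^bsub>P\<^esub> gcl GZ = gcl GZ \<otimes>\<^bsub>P\<^esub> gcl GX"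
      using comm[OF comms(2)] by simp
    show "gcl GY \<otimes>\<^bsub>P\<^esub> gcl GZ = gcl GZ \<otimes>\<^bsub>P\<^esub> gcl GY"
      using comm[OF comms(3)] by simp
  qed auto
  have letter: "\<exists>a b c. wclass ?R [l] = ?N a b c" for l
  proof -
    obtain g s where l: "l = (g, s)" by (cases l)
    have "wclass ?R [(g, True)] = gcl g"
      by (simp add: gcl_def gen_def)
    moreover have "wclass ?R [(g, False)] = inv\<^bsub>P\<^esub> gcl g"
      using wclass_winv[of ?R "gen g"] by (simp add: gcl_def P_def gen_def winv_def)
    ultimately have "wclass ?R [l] = gcl g [^]\<^bsub>P\<^esub> (if s then 1 else - 1 :: int)"
      by (simp add: l P.int_pow_neg)
    also have "\<dots> \<in> {?N 1 0 0, ?N (- 1) 0 0, ?N 0 1 0, ?N 0 (- 1) 0, ?N 0 0 1, ?N 0 0 (- 1)}"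
      by (cases g; cases s) simp_all
    finally show ?thesis by blast
  qed
  have word: "\<exists>a b c. wclass ?R w = ?N a b c" for w
  proof (induction w)
    case Nil
    have "wclass ?R [] = ?N 0 0 0" by (simp add: one)
    then show ?case by blast
  next
    case (Cons l w)
    have "wclass ?R (l # w) = wclass ?R [l] \<otimes>\<^bsub>P\<^esub> wclass ?R w"
      by (simp add: P_def presented_group_mult)
    then show ?case
      using Cons letter[of l] mult by metis
  qed
  interpret H: heisenberg_cover "heis_model ?M ?K" "heis_rep ?M ?K" ?M ?K
    using assms by (intro heisenberg_cover_model) (auto simp: le_imp_power_dvd)
  let ?f = "\<lambda>g. case g of GX \<Rightarrow> heis_rep ?M ?K 1 0 0 | GY \<Rightarrow> heis_rep ?M ?K 0 1 0
      | GZ \<Rightarrow> heis_rep ?M ?K 0 0 1"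
  have f: "?f g \<in> carrier (heis_model ?M ?K)" for g
    by (cases g) auto
  have "weval (heis_model ?M ?K) ?f u = weval (heis_model ?M ?K) ?f v" if "(u, v) \<in> ?R" for u v
  proof -
    \<comment> \<open>Natural powers are turned into integer powers so that
      \<open>H.N_int_pow\<close> evaluates the power relations.\<close>
    have pow: "weval (heis_model ?M ?K) ?f (wpow w k) = weval (heis_model ?M ?K) ?f w
        [^]\<^bsub>heis_model ?M ?K\<^esub> int k" for w k
      by (simp add: H.weval_wpow f int_pow_int)
    have "heis_rep ?M ?K (int ?M) 0 0 = heis_rep ?M ?K 0 0 0"
      "heis_rep ?M ?K 0 (int ?M) 0 = heis_rep ?M ?K 0 0 0"
      "heis_rep ?M ?K 0 0 (int ?K) = heis_rep ?M ?K 0 0 0"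
      unfolding H.N_eq_iff by (simp_all add: cong_0_iff)
    then show ?thesis
      using that unfolding xyz_relations_def
      by (auto simp: pow gen_def H.N_int_pow wcomm_def winv_def H.inv_N H.N_mult
          simp flip: H.N_zero)
  qed
  from H.presented_group_universal[of ?f, OF f this]
  obtain h where h: "h \<in> hom P (heis_model ?M ?K)" and h_gcl: "\<And>g. h (gcl g) = ?f g"
    by (auto simp: P_def gcl_def)
  interpret h: group_hom P "heis_model ?M ?K" h
    by unfold_locales (rule h)
  have "h (?N a b c) = heis_rep ?M ?K a b c" for a b c
    \<comment> \<open>The correction term is absent here, since the factors are already in the order
      x, y, z.\<close>
    by (simp add: h.hom_int_pow h_gcl H.N_int_pow H.N_mult)
  then have only_if: "heis_rep ?M ?K a b c = heis_rep ?M ?K a' b' c'"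
    if "?N a b c = ?N a' b' c'" for a b c a' b' c'
    using that by metis
  show ?thesis
  proof
    show "carrier P = {?N a b c |a b c. True}"
    proof
      show "carrier P \<subseteq> {?N a b c |a b c. True}"
        using word by (auto simp: P_def presented_group_def)
    qed auto
    show "?N a b c = ?N a' b' c' \<longleftrightarrow>
      [a = a'] (mod int ?M) \<and> [b = b'] (mod int ?M) \<and> [c = c'] (mod int ?K)"
      (is "?L \<longleftrightarrow> ?C") for a b c a' b' c'
    proof
      assume ?L
      then show ?C by (rule only_if[unfolded H.N_eq_iff])
    next
      assume ?C
      then have "gcl GX [^]\<^bsub>P\<^esub> a = gcl GX [^]\<^bsub>P\<^esub> a'" "gcl GY [^]\<^bsub>P\<^esub> b = gcl GY [^]\<^bsub>P\<^esub> b'"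
        "gcl GZ [^]\<^bsub>P\<^esub> c = gcl GZ [^]\<^bsub>P\<^esub> c'"
        by (simp_all add: P.int_pow_cong[OF gcl pows(1)] P.int_pow_cong[OF gcl pows(2)]
            P.int_pow_cong[OF gcl pows(3)])
      then show ?L by simp
    qed
  qed (use mult H.K_dvd_M H.M_pos in auto)
qed

theorem proposition3p3:
  fixes p n r :: nat
  assumes "prime p" and "p \<ge> 5" and "n \<ge> r" and "r \<ge> 1"
  shows "purely_strongly_real_beauville_group (presented_group (xyz_relations p n r))"
proof -
  have "\<not> p dvd 2" "\<not> p dvd 3"
    using assms(2) by (auto dest: dvd_imp_le)
  then have "coprime p 2" "coprime p 3"
    using assms(1) by (blast intro: prime_imp_coprime)+
  then have "coprime p (2 * 3)"
    by (simp only: coprime_mult_right_iff)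
  then have "coprime (p ^ n) 6"
    by simp
  moreover have "p > 0"
    using assms(2) by simp
  ultimately show ?thesis
    using heisenberg_cover_presented_group[OF _ assms(3)]
    by (intro heisenberg_cover_6.purely_strongly_real heisenberg_cover_6.intro
        heisenberg_cover_6_axioms.intro)
qed

end
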